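(* Let $1<p<\infty$. There exists a constant $c=c(p)$, depending only on $p$, such that for every $n\ge1$, every cube $Q_0\subset\mathbb{R}^n$ and every $f\in L^1(Q_0)$, \[ \bigl\|(M^d_{Q_0}f)^{\frac1p}\bigr\|_{JN^d_p(Q_0)}^p\le c\,\|f\|_{L^1(Q_0)}. \]
   Context: $|A|$ denotes Lebesgue measure and $f_A=\frac1{|A|}\int_A f\,dx$ the integral average. A cube in $\mathbb{R}^n$ is a closed bounded cube $[a_1,b_1]\times\dots\times[a_n,b_n]$ with sides parallel to the coordinate axes and $b_1-a_1=\dots=b_n-a_n>0$. Dyadic subcubes: for a cube $Q_0$, $\mathcal{D}(Q_0)=\bigcup_{j=0}^\infty \mathcal{D}_j(Q_0)$, where $\mathcal{D}_j(Q_0)$ consists of the $2^{jn}$ closed cubes of side length $2^{-j}l(Q_0)$ ($l(Q_0)$ being the side length of $Q_0$), with pairwise disjoint interiors, obtained by dividing each side of $Q_0$ into $2^j$ equal parts. Elements of $\mathcal{D}(Q_0)$ are the dyadic subcubes of $Q_0$. Collections of dyadic cubes are called pairwise disjoint if their interiors are pairwise disjoint. Dyadic John--Nirenberg space: for $1<p<\infty$, a function $f\in L^1(Q_0)$ belongs to $JN^d_p(Q_0)$ if \[ \|f\|_{JN^d_{p}(Q_0)}^p=\sup\sum_{i}|Q_i|\Bigl(\frac1{|Q_i|}\int_{Q_i}|f-f_{Q_i}|\,dx\Bigr)^p<\infty, \] where the supremum is taken over countable collections $\{Q_i\}$ of pairwise disjoint dyadic subcubes of $Q_0$. Dyadic maximal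 function: for $f\in L^1(Q_0)$ and $x\in Q_0$, \[ M^d_{Q_0}f(x)=\sup\frac1{|Q|}\int_Q|f(y)|\,dy, \] where the supremum is taken over all $Q\in\mathcal{D}(Q_0)$ with $x\in Q$. *)

theory Defs
  imports "HOL-Analysis.Analysis"
begin

text \<open>
  The constant of the theorem is chosen before the dimension \<open>n\<close>, so \<open>n\<close> cannot be a type.
  Euclidean \<open>n\<close>-space is therefore the set \<open>PiE {..<n} (\<lambda>_. UNIV)\<close> of functions
  \<open>nat \<Rightarrow> real\<close> that are \<open>undefined\<close> outside \<open>{..<n}\<close>, with the completed product measure
  (Lebesgue measure) and the product topology of the \<open>n\<close> coordinates.
\<close>

definition leb :: "nat \<Rightarrow> (nat \<Rightarrow> real) measure" where
  "leb n = completion (Pi\<^sub>M {..<n} (\<lambda>_. lborel))"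

definition cube :: "nat \<Rightarrow> (nat \<Rightarrow> real) \<Rightarrow> real \<Rightarrow> (nat \<Rightarrow> real) set" where
  "cube n a l = (\<Pi>\<^sub>E i\<in>{..<n}. {a i .. a i + l})"

definition cubes :: "nat \<Rightarrow> (nat \<Rightarrow> real) set set" where
  "cubes n = {Q. \<exists>a l. 0 < l \<and> Q = cube n a l}"

text \<open>
  The type-class \<open>interior\<close> refers to the topology of all of \<open>nat \<Rightarrow> real\<close>, in which every cube
  has empty interior; the interior has to be taken in \<open>n\<close>-space.
\<close>

definition cube_interior :: "nat \<Rightarrow> (nat \<Rightarrow> real) set \<Rightarrow> (nat \<Rightarrow> real) set" where
  "cube_interior n Q = product_topology (\<lambda>_. euclideanreal) {..<n} interior_of Q"

definition dyadic_level :: "nat \<Rightarrow> (nat \<Rightarrow> real) set \<Rightarrow> nat \<Rightarrow> (nat \<Rightarrow> real) set set" where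
  "dyadic_level n Q0 j =
    {Q. \<exists>a l. 0 < l \<and> Q0 = cube n a l \<and>
        (\<exists>k :: nat \<Rightarrow> nat. (\<forall>i<n. k i < 2 ^ j) \<and>
           Q = cube n (\<lambda>i. a i + real (k i) * (l / 2 ^ j)) (l / 2 ^ j))}"

definition dyadic :: "nat \<Rightarrow> (nat \<Rightarrow> real) set \<Rightarrow> (nat \<Rightarrow> real) set set" where
  "dyadic n Q0 = (\<Union>j. dyadic_level n Q0 j)"

definition avg :: "nat \<Rightarrow> (nat \<Rightarrow> real) set \<Rightarrow> ((nat \<Rightarrow> real) \<Rightarrow> real) \<Rightarrow> real" where
  "avg n A f = (1 / measure (leb n) A) * (LINT x:A|leb n. f x)"

definition L1 :: "nat \<Rightarrow> (nat \<Rightarrow> real) set \<Rightarrow> ((nat \<Rightarrow> real) \<Rightarrow> real) set" where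
  "L1 n A = {f. set_integrable (leb n) A f}"

definition L1_norm :: "nat \<Rightarrow> (nat \<Rightarrow> real) set \<Rightarrow> ((nat \<Rightarrow> real) \<Rightarrow> real) \<Rightarrow> real" where
  "L1_norm n A f = (LINT x:A|leb n. \<bar>f x\<bar>)"

text \<open>Powers of extended nonnegative numbers, meant for exponents \<open>a > 0\<close>.\<close>

definition epowr :: "ennreal \<Rightarrow> real \<Rightarrow> ennreal" where
  "epowr x a = (if x = \<infinity> then \<infinity> else ennreal (enn2real x powr a))"

text \<open>
  The norm is extended-valued. It is meaningful only for \<open>f\<close> in \<open>L1 n Q0\<close>, since Bochner
  integrals of non-integrable functions are \<open>0\<close>; membership in the space \<open>JNd\<close> includes
  integrability.
\<close>

definition JNd_norm :: "real \<Rightarrow> nat \<Rightarrow> (nat \<Rightarrow> real) set \<Rightarrow> ((nat \<Rightarrow> real) \<Rightarrow> real) \<Rightarrow> ennreal" where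
  "JNd_norm p n Q0 f = epowr
    (SUP C \<in> {C. C \<subseteq> dyadic n Q0 \<and> countable C \<and> disjoint_family_on (cube_interior n) C}.
       \<Sum>\<^sub>\<infinity>Q\<in>C. ennreal (measure (leb n) Q * avg n Q (\<lambda>x. \<bar>f x - avg n Q f\<bar>) powr p))
    (1 / p)"

definition JNd :: "real \<Rightarrow> nat \<Rightarrow> (nat \<Rightarrow> real) set \<Rightarrow> ((nat \<Rightarrow> real) \<Rightarrow> real) set" where
  "JNd p n Q0 = {f \<in> L1 n Q0. JNd_norm p n Q0 f < \<infinity>}"

text \<open>The supremum may be infinite at some points even if \<open>f\<close> is integrable.\<close>

definition Md :: "nat \<Rightarrow> (nat \<Rightarrow> real) set \<Rightarrow> ((nat \<Rightarrow> real) \<Rightarrow> real) \<Rightarrow> (nat \<Rightarrow> real) \<Rightarrow> ennreal" where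
  "Md n Q0 f x = (SUP Q \<in> {Q \<in> dyadic n Q0. x \<in> Q}. ennreal (avg n Q (\<lambda>y. \<bar>f y\<bar>)))"

end

theory Submission
  imports Defs
begin

text \<open>
  Put \<open>q = 1/p\<close> and \<open>M = M\<^sup>d f\<close>. For a dyadic cube \<open>Q\<close> let \<open>A\<close> be the average of \<open>\<bar>f\<bar>\<close> over \<open>Q\<close> and
  \<open>m \<ge> A\<close> the largest average over the dyadic cubes containing \<open>Q\<close>, so that \<open>M \<ge> m\<close> on \<open>Q\<close>.
  The function \<open>U(x, m) = m\<^sup>q + q/(1 - q) x m\<^bsup>q-1\<^esup>\<close> is affine in \<open>x\<close>, dominates \<open>m\<^sup>q\<close>, and satisfies
  \<open>U(x, max m x) \<le> U(x, m)\<close>. Hence, by backward induction over the dyadic levels, the average of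
  \<open>M\<^sup>q\<close> over \<open>Q\<close> is at most \<open>U(A, m) \<le> m\<^sup>q + q/(1 - q) A\<^sup>q\<close>. As \<open>M\<^sup>q \<ge> m\<^sup>q\<close>, the mean oscillation
  of \<open>M\<^sup>q\<close> over \<open>Q\<close> is at most \<open>2/(p - 1) A\<^sup>q\<close>. Its \<open>p\<close>-th power times \<open>\<bar>Q\<bar>\<close> is at most
  \<open>(2/(p - 1))\<^sup>p\<close> times the integral of \<open>\<bar>f\<bar>\<close> over \<open>Q\<close>, which is additive over disjoint cubes. No step
  involves the dimension.
\<close>

subsection \<open>Geometry of the dyadic grid\<close>

lemma cube_cong: "(\<And>i. i < n \<Longrightarrow> a i = b i) \<Longrightarrow> cube n a l = cube n b l"
  unfolding cube_def by (intro PiE_cong) auto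

text \<open>Nonempty products determine their factors. This makes the corner and side that are
  existentially quantified in \<open>dyadic_level\<close> unique; the side is read off from a
  coordinate, so at least one must exist.\<close>

lemma cube_eqD:
  assumes "cube n a l = cube n b r" "0 < l" "0 < r" "i < n"
  shows "a i = b i" "l = r"
proof -
  have "{a i..a i + l} = {b i..b i + r}"
    using assms PiE_eq_iff_not_empty[of "{..<n}" "\<lambda>i. {a i..a i + l}" "\<lambda>i. {b i..b i + r}"]
    unfolding cube_def by auto
  then show "a i = b i" "l = r"
    using assms by (auto simp: Icc_eq_Icc)
qed

lemma cube_in_sets_PiM: "cube n a l \<in> sets (Pi\<^sub>M {..<n} (\<lambda>_. lborel))"
  unfolding cube_def by (intro sets_PiM_I_finite) auto

lemma cube_in_sets [measurable]: "cube n a l \<in> sets (leb n)"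
  using cube_in_sets_PiM by (auto simp: leb_def)

lemma emeasure_cube:
  assumes "0 \<le> l"
  shows "emeasure (leb n) (cube n a l) = ennreal (l ^ n)"
proof -
  interpret product_sigma_finite "\<lambda>_. lborel :: real measure" ..
  have "emeasure (leb n) (cube n a l) = emeasure (Pi\<^sub>M {..<n} (\<lambda>_. lborel)) (cube n a l)"
    unfolding leb_def using cube_in_sets_PiM by simp
  also have "\<dots> = (\<Prod>i<n. emeasure lborel {a i..a i + l})"
    unfolding cube_def by (intro emeasure_PiM) auto
  also have "\<dots> = ennreal (l ^ n)"
    using assms by (simp add: ennreal_power)
  finally show ?thesis .
qed

lemma measure_cube: "0 \<le> l \<Longrightarrow> measure (leb n) (cube n a l) = l ^ n"
  by (simp add: measure_def emeasure_cube)

text \<open>The hyperplane is a product with one null factor. The other factors have infinite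
  measure, but zero times infinity is zero in \<open>ennreal\<close>.\<close>

lemma AE_coordinate_neq:
  assumes "i < n"
  shows "AE x in leb n. x i \<noteq> c"
proof -
  interpret product_sigma_finite "\<lambda>_. lborel :: real measure" ..
  let ?P = "Pi\<^sub>M {..<n} (\<lambda>_. lborel :: real measure)"
  let ?S = "\<Pi>\<^sub>E t\<in>{..<n}. if t = i then {c} else UNIV"
  have "emeasure ?P ?S = (\<Prod>t<n. emeasure lborel (if t = i then {c} else UNIV))"
    by (intro emeasure_PiM) auto
  also have "\<dots> = 0"
    using assms by (intro prod_zero) (auto intro!: bexI[of _ i])
  finally have "?S \<in> null_sets ?P"
    by (intro null_setsI) (auto intro!: sets_PiM_I_finite)
  then have "AE x in ?P. x i \<noteq> c"
    by (rule AE_I') (auto simp: space_PiM PiE_iff extensional_def)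
  then show ?thesis
    unfolding leb_def by (rule AE_completion)
qed

section \<open>Indexing of the dyadic grid\<close>

definition dcube :: "nat \<Rightarrow> (nat \<Rightarrow> real) \<Rightarrow> real \<Rightarrow> nat \<Rightarrow> (nat \<Rightarrow> nat) \<Rightarrow> (nat \<Rightarrow> real) set" where
  "dcube n a l j k = cube n (\<lambda>i. a i + real (k i) * (l / 2 ^ j)) (l / 2 ^ j)"

text \<open>Extensional functions serve as indices, so that each level is finite and each of its
  cubes has a single index.\<close>

definition idx :: "nat \<Rightarrow> nat \<Rightarrow> (nat \<Rightarrow> nat) set" where
  "idx n j = (\<Pi>\<^sub>E i\<in>{..<n}. {..<2 ^ j})"

text \<open>Halving the grid intervals splits number k of level j into numbers 2k and 2k + 1 of
  level j + 1.\<close>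

definition children :: "nat \<Rightarrow> (nat \<Rightarrow> nat) \<Rightarrow> (nat \<Rightarrow> nat) set" where
  "children n k = (\<Pi>\<^sub>E i\<in>{..<n}. {2 * k i, 2 * k i + 1})"

text \<open>
  Closed cubes of one level overlap in their faces. Generic points lie on none of the countably
  many grid hyperplanes, so each belongs to exactly one cube of every level.
\<close>

definition generic :: "nat \<Rightarrow> (nat \<Rightarrow> real) \<Rightarrow> real \<Rightarrow> (nat \<Rightarrow> real) \<Rightarrow> bool" where
  "generic n a l x \<longleftrightarrow> (\<forall>i<n. \<forall>j t :: nat. x i \<noteq> a i + real t * (l / 2 ^ j))"

lemma AE_generic: "AE x in leb n. generic n a l x"
proof -
  have "AE x in leb n. \<forall>i\<in>{..<n}. \<forall>j t :: nat. x i \<noteq> a i + real t * (l / 2 ^ j)"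
    by (intro AE_finite_allI) (auto simp: AE_all_countable intro!: AE_coordinate_neq)
  then show ?thesis
    unfolding generic_def by (simp only: lessThan_iff Ball_def)
qed

lemma finite_idx [simp]: "finite (idx n j)"
  unfolding idx_def by (intro finite_PiE) auto

lemma finite_children [simp]: "finite (children n k)"
  unfolding children_def by (intro finite_PiE) auto

lemma mem_dcube:
  "x \<in> dcube n a l j k \<longleftrightarrow> x \<in> extensional {..<n} \<and>
     (\<forall>i<n. a i + real (k i) * (l / 2 ^ j) \<le> x i \<and> x i \<le> a i + (real (k i) + 1) * (l / 2 ^ j))"
  unfolding dcube_def cube_def PiE_iff by (auto simp: distrib_right algebra_simps add_divide_distrib)

lemma dyadic_cube:
  assumes "1 \<le> n" "0 < l"
  shows "dyadic n (cube n a l) = (\<Union>j. dcube n a l j ` idx n j)"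
proof -
  have "dyadic_level n (cube n a l) j = dcube n a l j ` idx n j" for j
  proof (intro set_eqI iffI)
    fix Q assume "Q \<in> dyadic_level n (cube n a l) j"
    then obtain b r k where b: "0 < r" "cube n a l = cube n b r" "\<forall>i<n. k i < 2 ^ j"
      "Q = cube n (\<lambda>i. b i + real (k i) * (r / 2 ^ j)) (r / 2 ^ j)"
      unfolding dyadic_level_def by blast
    have "l = r" "\<And>i. i < n \<Longrightarrow> a i = b i"
      using cube_eqD[OF b(2) assms(2) b(1)] assms by auto
    then have "Q = dcube n a l j (restrict k {..<n})"
      unfolding b dcube_def by (auto intro!: cube_cong)
    then show "Q \<in> dcube n a l j ` idx n j"
      using b(3) by (auto simp: idx_def)
  next
    fix Q assume "Q \<in> dcube n a l j ` idx n j"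
    then show "Q \<in> dyadic_level n (cube n a l) j"
      using assms unfolding dyadic_level_def idx_def dcube_def PiE_iff
      by (intro CollectI exI[of _ a] exI[of _ l]) auto
  qed
  then show ?thesis
    by (simp add: dyadic_def)
qed

lemma children_subset_idx: "k \<in> idx n j \<Longrightarrow> children n k \<subseteq> idx n (Suc j)"
proof
  fix k' assume k: "k \<in> idx n j" "k' \<in> children n k"
  have "k' i < 2 ^ Suc j" if "i < n" for i
  proof -
    have "k i < 2 ^ j" "k' i = 2 * k i \<or> k' i = 2 * k i + 1"
      using k that by (auto simp: idx_def children_def PiE_iff)
    then show ?thesis
      by auto
  qed
  then show "k' \<in> idx n (Suc j)"
    using k by (auto simp: idx_def children_def PiE_iff)
qed

lemma dcube_child_subset:
  assumes "0 < l" "k' \<in> children n k"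
  shows "dcube n a l (Suc j) k' \<subseteq> dcube n a l j k"
proof
  fix x assume x: "x \<in> dcube n a l (Suc j) k'"
  define h where "h = l / 2 ^ Suc j"
  have h: "0 < h" "l / 2 ^ j = 2 * h"
    using assms by (auto simp: h_def)
  have "a i + real (k i) * (2 * h) \<le> x i \<and> x i \<le> a i + (real (k i) + 1) * (2 * h)" if "i < n" for i
  proof -
    have "k' i = 2 * k i \<or> k' i = 2 * k i + 1"
      using assms that by (auto simp: children_def PiE_iff)
    moreover have "a i + real (k' i) * h \<le> x i" "x i \<le> a i + (real (k' i) + 1) * h"
      using x that by (auto simp: mem_dcube h_def)
    ultimately show ?thesis
      using h(1) by (auto simp: algebra_simps)
  qed
  then show "x \<in> dcube n a l j k"
    using x unfolding mem_dcube h by auto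
qed

lemma dcube_subset_children:
  assumes "0 < l" "x \<in> dcube n a l j k"
  obtains k' where "k' \<in> children n k" "x \<in> dcube n a l (Suc j) k'"
proof -
  define h where "h = l / 2 ^ Suc j"
  have h: "0 < h" "l / 2 ^ j = 2 * h"
    using assms by (auto simp: h_def)
  \<comment> \<open>Each interval is cut at its midpoint; a midpoint lies in both closed halves and
    goes to the lower one.\<close>
  define k' where
    "k' = (\<lambda>i\<in>{..<n}. if x i \<le> a i + real (2 * k i + 1) * h then 2 * k i else 2 * k i + 1)"
  have "k' \<in> children n k"
    by (auto simp: children_def k'_def)
  moreover have "a i + real (k' i) * h \<le> x i \<and> x i \<le> a i + (real (k' i) + 1) * h" if "i < n" for i
    using assms(2) that unfolding mem_dcube h k'_def by (auto simp: algebra_simps)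
  then have "x \<in> dcube n a l (Suc j) k'"
    using assms(2) unfolding mem_dcube h_def by auto
  ultimately show ?thesis
    by (rule that)
qed

lemma generic_dcube_unique:
  assumes "0 < l" "generic n a l x" "k \<in> idx n j" "k' \<in> idx n j"
    "x \<in> dcube n a l j k" "x \<in> dcube n a l j k'"
  shows "k = k'"
proof (rule PiE_ext[where k = "{..<n}" and s = "\<lambda>_. {..<2 ^ j}"])
  show "k \<in> {..<n} \<rightarrow>\<^sub>E {..<2 ^ j}" "k' \<in> {..<n} \<rightarrow>\<^sub>E {..<2 ^ j}"
    using assms by (auto simp: idx_def)
  fix i assume i: "i \<in> {..<n}"
  define h where "h = l / 2 ^ j"
  have h: "0 < h"
    using assms by (auto simp: h_def)
  have ne: "x i \<noteq> a i + real t * h" for t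
    using assms(2) i by (auto simp: generic_def h_def)
  have *: "a i + real (k i) * h \<le> x i" "x i \<le> a i + real (Suc (k i)) * h"
    "a i + real (k' i) * h \<le> x i" "x i \<le> a i + real (Suc (k' i)) * h"
    using assms(5,6) i by (auto simp: mem_dcube h_def algebra_simps)
  \<comment> \<open>Genericity makes these strict, so k < k' + 1 and k' < k + 1 as integers, which
    forces equality.\<close>
  have "real (k i) * h < real (Suc (k' i)) * h" "real (k' i) * h < real (Suc (k i)) * h"
    using * ne[of "k i"] ne[of "k' i"] by linarith+
  then show "k i = k' i"
    using h by simp
qed

lemma dcube_0: "dcube n a l 0 (\<lambda>i\<in>{..<n}. 0) = cube n a l"
  unfolding dcube_def by (auto intro!: cube_cong)

lemma idx_0: "idx n 0 = {\<lambda>i\<in>{..<n}. 0}"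
  unfolding idx_def PiE_eq_singleton by auto

lemma dcube_ancestor:
  assumes "0 < l" "k \<in> idx n j" "i \<le> j"
  shows "\<exists>k'\<in>idx n i. dcube n a l j k \<subseteq> dcube n a l i k'"
  using assms(3,2)
proof (induction arbitrary: k rule: dec_induct)
  case base
  then show ?case
    by blast
next
  case (step j)
  define k' where "k' = (\<lambda>i\<in>{..<n}. k i div 2)"
  have "k' \<in> idx n j"
    using step.prems by (force simp: k'_def idx_def PiE_iff)
  moreover have "k \<in> children n k'"
    using step.prems by (auto simp: k'_def idx_def children_def PiE_iff)
  ultimately show ?case
    using step.IH[of k'] dcube_child_subset[OF assms(1)] by blast
qed

lemma dcube_subset_cube:
  assumes "0 < l" "k \<in> idx n j"
  shows "dcube n a l j k \<subseteq> cube n a l"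
  using dcube_ancestor[OF assms, of 0] by (simp add: idx_0 dcube_0 del: restrict_apply)

lemma cube_covered:
  assumes "0 < l" "x \<in> cube n a l"
  shows "\<exists>k\<in>idx n j. x \<in> dcube n a l j k"
proof (induction j)
  case 0
  then show ?case
    using assms by (simp add: idx_0 dcube_0 del: restrict_apply)
next
  case (Suc j)
  then obtain k where k: "k \<in> idx n j" "x \<in> dcube n a l j k"
    by blast
  then obtain k' where "k' \<in> children n k" "x \<in> dcube n a l (Suc j) k'"
    using dcube_subset_children[OF assms(1)] by metis
  then show ?case
    using children_subset_idx[OF k(1)] by blast
qed

text \<open>Disjointness of a collection concerns interiors only. This turns it into disjointness of
  the closed cubes at generic points.\<close>

lemma generic_mem_interior:
  assumes "generic n a l x" "x \<in> dcube n a l j k"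
  shows "x \<in> cube_interior n (dcube n a l j k)"
proof -
  define h where "h = l / 2 ^ j"
  define b where "b = (\<lambda>i. a i + real (k i) * h)"
  define B where "B = (\<Pi>\<^sub>E i\<in>{..<n}. {b i<..<b i + h})"
  have "openin (product_topology (\<lambda>_. euclideanreal) {..<n}) B"
    unfolding B_def by (subst openin_PiE) auto
  moreover have "B \<subseteq> dcube n a l j k"
    unfolding B_def dcube_def cube_def b_def h_def by (intro PiE_mono) auto
  moreover have "b i < x i \<and> x i < b i + h" if "i < n" for i
  proof -
    have "x i \<noteq> a i + real (k i) * h" "x i \<noteq> a i + real (Suc (k i)) * h"
      using assms(1) that unfolding generic_def h_def by blast+
    moreover have "a i + real (k i) * h \<le> x i" "x i \<le> a i + (real (k i) + 1) * h"
      using assms(2) that unfolding mem_dcube h_def by blast+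
    ultimately show ?thesis
      unfolding b_def by (simp add: distrib_right)
  qed
  then have "x \<in> B"
    using assms(2) by (simp add: B_def mem_dcube PiE_iff)
  ultimately show ?thesis
    unfolding cube_interior_def using interior_of_maximal by blast
qed

subsection \<open>The Bellman function\<close>

text \<open>By Doob's maximal inequality a nonnegative martingale started at x ever exceeds t with
  probability at most x/t. Integrating q t^(q-1) x/t over t > m and adding m^q gives this bound for
  the q-th moment of the maximum of m and the running supremum. Since \<open>0 powr a = 0\<close>,
  the value at m = 0 is 0.\<close>

definition bellman :: "real \<Rightarrow> real \<Rightarrow> real \<Rightarrow> real" where
  "bellman q x m = m powr q + q / (1 - q) * x * m powr (q - 1)"

text \<open>For x > m the claim, multiplied by 1 - q, reads x^q \<le> q x m^(q-1) + (1-q) m^q. This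
  is Young's inequality, or the tangent at m to a concave power. It fails for m = 0 < x, where the
  right-hand side is 0 by the convention for \<open>powr\<close>.\<close>

lemma bellman_max_le:
  assumes "0 < q" "q < 1" "0 \<le> x" "0 < m"
  shows "bellman q x (max m x) \<le> bellman q x m"
proof (cases "x \<le> m")
  case False
  then have x: "m < x" "0 < x" using assms by auto
  have "x powr q * m powr (1 - q) \<le> q * x + (1 - q) * m"
    using Youngs_inequality_0[of q "1 - q" x m] assms x by auto
  then have "x powr q * m powr (1 - q) * m powr (q - 1) \<le> (q * x + (1 - q) * m) * m powr (q - 1)"
    by (intro mult_right_mono) auto
  moreover have "m powr (1 - q) * m powr (q - 1) = 1" "m * m powr (q - 1) = m powr q"
    "x * x powr (q - 1) = x powr q"
    using assms x by (auto simp: powr_add[symmetric] powr_mult_base)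
  ultimately have "x powr q \<le> q * x * m powr (q - 1) + (1 - q) * m powr q"
    by (simp add: distrib_right mult.assoc)
  then have "x powr q / (1 - q) \<le> (q * x * m powr (q - 1) + (1 - q) * m powr q) / (1 - q)"
    using assms by (intro divide_right_mono) auto
  moreover have "bellman q x x = x powr q / (1 - q)"
    using assms \<open>x * x powr (q - 1) = x powr q\<close>
    by (simp add: bellman_def mult.assoc) (simp add: field_simps)
  moreover have "bellman q x m = (q * x * m powr (q - 1) + (1 - q) * m powr q) / (1 - q)"
    using assms by (simp add: bellman_def field_simps)
  ultimately show ?thesis
    using x by (simp add: max_def)
qed (simp add: max_def)

text \<open>As q - 1 < 0, the power m^(q-1) is at most x^(q-1). The remaining term m^q is the one
  that cancels in the mean oscillation.\<close>

lemma bellman_le: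
  assumes "0 < q" "q < 1" "0 \<le> x" "x \<le> m"
  shows "bellman q x m \<le> m powr q + q / (1 - q) * x powr q"
proof (cases "x = 0")
  case False
  then have "x * m powr (q - 1) \<le> x * x powr (q - 1)"
    using assms by (intro mult_left_mono powr_mono2') auto
  also have "\<dots> = x powr q"
    using assms False by (simp add: powr_mult_base)
  finally show ?thesis
    using assms unfolding bellman_def mult.assoc by (simp add: divide_right_mono mult_left_mono)
qed (simp add: bellman_def)

lemma bellman_ge: "0 < q \<Longrightarrow> q < 1 \<Longrightarrow> 0 \<le> x \<Longrightarrow> m powr q \<le> bellman q x m"
  by (simp add: bellman_def)

subsection \<open>Extended-valued powers\<close>

text \<open>If the right-hand side is a finite s, every \<open>r N\<close> is at most
  \<open>s powr (1 / q)\<close>, so the supremum on the left is finite as well.\<close>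

lemma epowr_SUP_le:
  assumes "0 < q" "\<And>N. 0 \<le> r N"
  shows "epowr (SUP N. ennreal (r N)) q \<le> (SUP N. ennreal (r N powr q))"
proof (cases "SUP N. ennreal (r N powr q)")
  case (real s)
  have "r N \<le> s powr (1 / q)" for N
  proof -
    have "ennreal (r N powr q) \<le> ennreal s"
      unfolding real(2)[symmetric] by (rule SUP_upper) auto
    then have "(r N powr q) powr (1 / q) \<le> s powr (1 / q)"
      using real(1) assms by (intro powr_mono2) auto
    then show ?thesis
      using assms by (simp add: powr_powr)
  qed
  then have *: "(SUP N. ennreal (r N)) \<le> ennreal (s powr (1 / q))"
    by (intro SUP_least ennreal_leI)
  then have "enn2real (SUP N. ennreal (r N)) \<le> s powr (1 / q)"
    by (intro enn2real_leI) auto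
  then have "enn2real (SUP N. ennreal (r N)) powr q \<le> (s powr (1 / q)) powr q"
    using assms by (intro powr_mono2) auto
  also have "\<dots> = s"
    using assms real by (simp add: powr_powr)
  finally have "enn2real (SUP N. ennreal (r N)) powr q \<le> s" .
  moreover have "(SUP N. ennreal (r N)) \<noteq> \<infinity>"
    using * by (metis ennreal_neq_top infinity_ennreal_def top.extremum_uniqueI)
  ultimately show ?thesis
    unfolding epowr_def real(2) by (simp only: if_False ennreal_leI)
next
  case top
  then show ?thesis
    by (simp only: top_greatest)
qed

lemma measurable_epowr [measurable]: "(\<lambda>x. epowr x q) \<in> borel_measurable borel"
  unfolding epowr_def by measurable

lemma epowr_less_top_iff: "epowr x q < \<infinity> \<longleftrightarrow> x < \<infinity>"
  by (auto simp: epowr_def less_top)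

lemma epowr_epowr_inverse: "0 < p \<Longrightarrow> epowr (epowr x (1 / p)) p = x"
  by (cases x) (auto simp: epowr_def powr_powr)

text \<open>Preimages under the two functions differ by a null set, which is measurable by
  completeness. It serves for \<open>Md\<close>, which is identified with a supremum of measurable
  functions only at generic points.\<close>

lemma borel_measurable_AE_completion:
  assumes "g \<in> borel_measurable (completion M)" "AE x in completion M. g x = h x"
  shows "h \<in> borel_measurable (completion M)"
proof (rule measurableI)
  fix B :: "'b set" assume "B \<in> sets borel"
  then have "g -` B \<inter> space (completion M) \<in> sets (completion M)"
    using assms(1) by (rule measurable_sets[rotated])
  moreover have "AE x in completion M.
      x \<in> g -` B \<inter> space (completion M) \<longleftrightarrow> x \<in> h -` B \<inter> space (completion M)"
    using assms(2) by eventually_elim (simp only: vimage_eq Int_iff)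
  ultimately show "h -` B \<inter> space (completion M) \<in> sets (completion M)"
    using completion.in_sets_AE Int_lower2 by metis
qed simp

subsection \<open>The dyadic maximal function\<close>

locale integrable_on_cube =
  fixes n :: nat and a :: "nat \<Rightarrow> real" and l :: real and f :: "(nat \<Rightarrow> real) \<Rightarrow> real"
  assumes l_pos: "0 < l"
    and integrable_f: "set_integrable (leb n) (cube n a l) f"
begin

abbreviation D :: "nat \<Rightarrow> (nat \<Rightarrow> nat) \<Rightarrow> (nat \<Rightarrow> real) set" where
  "D \<equiv> dcube n a l"

definition vol :: "nat \<Rightarrow> real" where
  "vol j = (l / 2 ^ j) ^ n"

definition A :: "nat \<Rightarrow> (nat \<Rightarrow> nat) \<Rightarrow> real" where
  "A j k = avg n (D j k) (\<lambda>y. \<bar>f y\<bar>)"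

text \<open>At generic points this is the conditional expectation of \<bar>f\<bar> on the grid of
  level j. On common faces several terms add up, which is harmless on a null set, and the finite sum
  is visibly measurable.\<close>

definition X :: "nat \<Rightarrow> (nat \<Rightarrow> real) \<Rightarrow> real" where
  "X j x = (\<Sum>k\<in>idx n j. A j k * indicator (D j k) x)"

text \<open>The starting level is a parameter so that the backward induction can pass from a cube to
  its children.\<close>

definition MX :: "nat \<Rightarrow> nat \<Rightarrow> (nat \<Rightarrow> real) \<Rightarrow> real" where
  "MX i j x = Max ((\<lambda>t. X t x) ` {i..j})"

section \<open>Averages on one level and additivity over children\<close>

lemma vol_pos: "0 < vol j"
  using l_pos by (simp add: vol_def)

lemma D_sets [measurable]: "D j k \<in> sets (leb n)"
  by (simp add: dcube_def)

lemma emeasure_D: "emeasure (leb n) (D j k) = ennreal (vol j)"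
  using l_pos by (simp add: dcube_def emeasure_cube vol_def)

lemma measure_D: "measure (leb n) (D j k) = vol j"
  using l_pos by (simp add: dcube_def measure_cube vol_def)

lemma set_integrable_D:
  assumes "set_integrable (leb n) (cube n a l) g" "k \<in> idx n j"
  shows "set_integrable (leb n) (D j k) (g :: _ \<Rightarrow> real)"
  using assms(1) by (rule set_integrable_subset) (auto dest: dcube_subset_cube[OF l_pos assms(2), THEN subsetD])

lemma A_nonneg: "0 \<le> A j k"
  unfolding A_def avg_def set_lebesgue_integral_def by (auto intro!: mult_nonneg_nonneg)

lemma vol_mult_A: "vol j * A j k = (LINT x:D j k|leb n. \<bar>f x\<bar>)"
  using vol_pos[of j] by (simp add: A_def avg_def measure_D)

lemma generic_X:
  assumes "generic n a l x" "k \<in> idx n j" "x \<in> D j k"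
  shows "X j x = A j k"
proof -
  have "X j x = (\<Sum>k'\<in>idx n j. if k' = k then A j k else 0)"
    unfolding X_def
  proof (rule sum.cong)
    fix k' assume "k' \<in> idx n j"
    then have "x \<in> D j k' \<longleftrightarrow> k' = k"
      using generic_dcube_unique[OF l_pos assms(1) _ assms(2) _ assms(3)] assms by blast
    then show "A j k' * indicator (D j k') x = (if k' = k then A j k else 0)"
      by (simp add: indicator_def)
  qed simp
  then show ?thesis
    using assms by simp
qed

text \<open>Children overlap in faces, hence the restriction to generic points. The value type is
  general because the identity enters both real and \<open>ennreal\<close> integrals.\<close>

lemma indicator_children:
  assumes "generic n a l x" "k \<in> idx n j"
  shows "(indicator (D j k) x :: 'b :: semiring_1) = (\<Sum>k'\<in>children n k. indicator (D (Suc j) k') x)"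
proof (cases "x \<in> D j k")
  case True
  then obtain k' where k': "k' \<in> children n k" "x \<in> D (Suc j) k'"
    using dcube_subset_children[OF l_pos] by metis
  have "(\<Sum>k'\<in>children n k. indicator (D (Suc j) k') x) =
      (\<Sum>k''\<in>children n k. if k'' = k' then 1 else (0 :: 'b))"
  proof (rule sum.cong)
    fix k'' assume "k'' \<in> children n k"
    then have "x \<in> D (Suc j) k'' \<longleftrightarrow> k'' = k'"
      using generic_dcube_unique[OF l_pos assms(1) _ _ _ k'(2)] children_subset_idx[OF assms(2)] k'
      by blast
    then show "(indicator (D (Suc j) k'') x :: 'b) = (if k'' = k' then 1 else 0)"
      by (simp add: indicator_def)
  qed simp
  then show ?thesis
    using k' True by simp
next
  case False
  then have "x \<notin> D (Suc j) k'" if "k' \<in> children n k" for k'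
    using dcube_child_subset[OF l_pos that] by blast
  then show ?thesis
    using False by simp
qed

lemma set_integral_children:
  assumes "set_integrable (leb n) (cube n a l) g" "k \<in> idx n j"
  shows "(LINT x:D j k|leb n. g x) = (\<Sum>k'\<in>children n k. LINT x:D (Suc j) k'|leb n. (g x :: real))"
proof -
  have int: "set_integrable (leb n) (D (Suc j) k') g" if "k' \<in> children n k" for k'
    using children_subset_idx[OF assms(2)] that by (intro set_integrable_D assms(1)) auto
  have "(\<Sum>k'\<in>children n k. LINT x:D (Suc j) k'|leb n. g x) =
      (LINT x|leb n. (\<Sum>k'\<in>children n k. indicator (D (Suc j) k') x *\<^sub>R g x))"
    unfolding set_lebesgue_integral_def
    by (intro Bochner_Integration.integral_sum[symmetric] int[unfolded set_integrable_def])
  also have "\<dots> = (LINT x:D j k|leb n. g x)"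
    unfolding set_lebesgue_integral_def
  proof (rule integral_cong_AE)
    show "AE x in leb n. (\<Sum>k'\<in>children n k. indicator (D (Suc j) k') x *\<^sub>R g x) =
        indicator (D j k) x *\<^sub>R g x"
      using AE_generic[of n a l]
      by eventually_elim (simp add: indicator_children[OF _ assms(2)] sum_distrib_right)
    show "(\<lambda>x. \<Sum>k'\<in>children n k. indicator (D (Suc j) k') x *\<^sub>R g x) \<in> borel_measurable (leb n)"
      using int unfolding set_integrable_def by (intro borel_measurable_sum) auto
    show "(\<lambda>x. indicator (D j k) x *\<^sub>R g x) \<in> borel_measurable (leb n)"
      using set_integrable_D[OF assms] unfolding set_integrable_def by auto
  qed
  finally show ?thesis by simp
qed

lemma set_integrable_const: "set_integrable (leb n) (cube n a l) (\<lambda>_. c :: real)"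
  unfolding set_integrable_def using l_pos by (simp add: emeasure_cube)

text \<open>Additivity of the integral for the constant 1 replaces counting the children.\<close>

lemma sum_vol_children:
  assumes "k \<in> idx n j"
  shows "(\<Sum>k'\<in>children n k. vol (Suc j)) = vol j"
  using set_integral_children[OF set_integrable_const[of 1] assms]
  by (simp add: set_integral_const emeasure_D measure_D)

text \<open>This is the martingale property of the averages.\<close>

lemma sum_A_children:
  assumes "k \<in> idx n j"
  shows "(\<Sum>k'\<in>children n k. vol (Suc j) * A (Suc j) k') = vol j * A j k"
  unfolding vol_mult_A using set_integral_children[OF set_integrable_abs[OF integrable_f] assms]
  by simp

section \<open>Running maxima and the Bellman induction\<close>

lemma X_measurable [measurable]: "X j \<in> borel_measurable (leb n)"
  unfolding X_def by measurable

lemma MX_measurable [measurable]: "MX i j \<in> borel_measurable (leb n)"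
  unfolding MX_def by measurable

lemma X_nonneg: "0 \<le> X j x"
  unfolding X_def by (intro sum_nonneg mult_nonneg_nonneg A_nonneg) auto

lemma X_le_MX: "i \<le> t \<Longrightarrow> t \<le> j \<Longrightarrow> X t x \<le> MX i j x"
  unfolding MX_def by (intro Max_ge) auto

lemma MX_nonneg: "i \<le> j \<Longrightarrow> 0 \<le> MX i j x"
  using X_le_MX[of i i j x] X_nonneg[of i x] by auto

lemma MX_split:
  assumes "i \<le> j" "j \<le> t"
  shows "MX i t x = max (MX i j x) (MX j t x)"
proof -
  have "{i..t} = {i..j} \<union> {j..t}"
    using assms by auto
  then show ?thesis
    using assms unfolding MX_def by (simp add: image_Un Max_Un)
qed

lemma MX_Suc: "MX i (i + Suc N) x = max (X i x) (MX (Suc i) (Suc i + N) x)"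
proof -
  have "{i..i + Suc N} = insert i {Suc i..Suc i + N}"
    by auto
  then show ?thesis
    unfolding MX_def by simp
qed

text \<open>Induction on the number N of further levels, with the cube and the inherited maximum m
  arbitrary. Level j is absorbed into \<open>max m (A j k)\<close>, which is passed on to every
  child.\<close>

lemma nn_integral_MX_powr_le:
  assumes "0 < q" "q < 1" "k \<in> idx n j" "0 \<le> m"
  shows "(\<integral>\<^sup>+x. ennreal (max m (MX j (j + N) x) powr q) * indicator (D j k) x \<partial>leb n)
    \<le> ennreal (vol j * bellman q (A j k) (max m (A j k)))"
  using assms(3,4)
proof (induction N arbitrary: j k m)
  case 0
  have "(\<integral>\<^sup>+x. ennreal (max m (MX j (j + 0) x) powr q) * indicator (D j k) x \<partial>leb n) =
     (\<integral>\<^sup>+x. ennreal (max m (A j k) powr q) * indicator (D j k) x \<partial>leb n)"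
  proof (rule nn_integral_cong_AE)
    show "AE x in leb n. ennreal (max m (MX j (j + 0) x) powr q) * indicator (D j k) x =
        ennreal (max m (A j k) powr q) * indicator (D j k) x"
      using AE_generic[of n a l]
    proof eventually_elim
      case (elim x)
      then show ?case
        using generic_X[OF elim 0(1)] by (cases "x \<in> D j k") (simp_all add: MX_def)
    qed
  qed
  also have "\<dots> = ennreal (vol j * max m (A j k) powr q)"
    by (subst nn_integral_cmult_indicator) (simp_all add: emeasure_D ennreal_mult'' mult.commute)
  also have "\<dots> \<le> ennreal (vol j * bellman q (A j k) (max m (A j k)))"
    using vol_pos[of j] assms A_nonneg by (intro ennreal_leI mult_left_mono bellman_ge) auto
  finally show ?case .
next
  case (Suc N)
  define m' where "m' = max m (A j k)"
  have m': "0 \<le> m'" "A j k \<le> m'"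
    using Suc.prems by (auto simp: m'_def)
  note ch = children_subset_idx[OF Suc.prems(1), THEN subsetD]
  have bell: "bellman q (A (Suc j) k') (max m' (A (Suc j) k')) \<le> bellman q (A (Suc j) k') m'"
    if k': "k' \<in> children n k" for k'
  \<comment> \<open>\<open>bellman_max_le\<close> requires m' > 0. If m' = 0, the average over the
    parent vanishes, hence so do those over the children, and the maximum changes nothing.\<close>
  proof (cases "m' = 0")
    case True
    then have "A j k = 0"
      using m' A_nonneg[of j k] by auto
    then have "(\<Sum>k'\<in>children n k. vol (Suc j) * A (Suc j) k') = 0"
      using sum_A_children[OF Suc.prems(1)] by simp
    then have "vol (Suc j) * A (Suc j) k' = 0"
      using k' sum_nonneg_eq_0_iff[of "children n k" "\<lambda>k'. vol (Suc j) * A (Suc j) k'"]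
        mult_nonneg_nonneg[OF less_imp_le[OF vol_pos[of "Suc j"]] A_nonneg]
      by auto
    then show ?thesis
      using vol_pos[of "Suc j"] True by simp
  next
    case False
    then show ?thesis
      using m' assms A_nonneg by (intro bellman_max_le) auto
  qed
  have "(\<integral>\<^sup>+x. ennreal (max m (MX j (j + Suc N) x) powr q) * indicator (D j k) x \<partial>leb n) =
     (\<integral>\<^sup>+x. (\<Sum>k'\<in>children n k.
        ennreal (max m' (MX (Suc j) (Suc j + N) x) powr q) * indicator (D (Suc j) k') x) \<partial>leb n)"
  proof (rule nn_integral_cong_AE)
    show "AE x in leb n. ennreal (max m (MX j (j + Suc N) x) powr q) * indicator (D j k) x =
      (\<Sum>k'\<in>children n k.
        ennreal (max m' (MX (Suc j) (Suc j + N) x) powr q) * indicator (D (Suc j) k') x)"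
      using AE_generic[of n a l]
    proof eventually_elim
      case (elim x)
      have "max m (MX j (j + Suc N) x) = max m' (MX (Suc j) (Suc j + N) x)" if "x \<in> D j k"
        unfolding MX_Suc generic_X[OF elim Suc.prems(1) that] m'_def by (simp add: max.assoc)
      then have "ennreal (max m (MX j (j + Suc N) x) powr q) * indicator (D j k) x =
          ennreal (max m' (MX (Suc j) (Suc j + N) x) powr q) * indicator (D j k) x"
        by (cases "x \<in> D j k") auto
      then show ?case
        by (simp only: indicator_children[OF elim Suc.prems(1)] sum_distrib_left)
    qed
  qed
  also have "\<dots> = (\<Sum>k'\<in>children n k. \<integral>\<^sup>+x.
        ennreal (max m' (MX (Suc j) (Suc j + N) x) powr q) * indicator (D (Suc j) k') x \<partial>leb n)"
    by (intro nn_integral_sum) measurable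
  also have "\<dots> \<le> (\<Sum>k'\<in>children n k. ennreal (vol (Suc j) * bellman q (A (Suc j) k') m'))"
  proof (intro sum_mono order_trans[OF Suc.IH] ennreal_leI mult_left_mono bell)
  qed (use ch m' vol_pos[of "Suc j"] in auto)
  also have "\<dots> = ennreal (\<Sum>k'\<in>children n k. vol (Suc j) * bellman q (A (Suc j) k') m')"
    using vol_pos[of "Suc j"] assms A_nonneg
    by (intro sum_ennreal mult_nonneg_nonneg) (auto simp: bellman_def)
  \<comment> \<open>For fixed m' the Bellman function is affine in x, so only the total volume and
    the total mass of the children enter, and these are those of the parent.\<close>
  also have "(\<Sum>k'\<in>children n k. vol (Suc j) * bellman q (A (Suc j) k') m') =
     (\<Sum>k'\<in>children n k. vol (Suc j)) * m' powr q +
     q / (1 - q) * m' powr (q - 1) * (\<Sum>k'\<in>children n k. vol (Suc j) * A (Suc j) k')"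
    unfolding sum_distrib_left sum_distrib_right sum.distrib[symmetric]
    by (intro sum.cong) (auto simp: bellman_def algebra_simps)
  also have "\<dots> = vol j * bellman q (A j k) m'"
    unfolding sum_vol_children[OF Suc.prems(1)] sum_A_children[OF Suc.prems(1)]
    by (simp add: bellman_def algebra_simps)
  finally show ?case
    by (simp add: m'_def)
qed

section \<open>The maximal function as a supremum of running maxima\<close>

lemma MX_mono: "i \<le> s \<Longrightarrow> s \<le> t \<Longrightarrow> MX i s x \<le> MX i t x"
  unfolding MX_def by (intro Max_mono) auto

text \<open>A generic point of the cube lies in exactly one dyadic cube of each level, and the
  average over that cube is the value of \<open>X\<close> there.\<close>

lemma Md_generic:
  assumes "1 \<le> n" "generic n a l x" "x \<in> cube n a l"
  shows "Md n (cube n a l) f x = (SUP N. ennreal (MX 0 N x))"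
proof (rule antisym)
  show "Md n (cube n a l) f x \<le> (SUP N. ennreal (MX 0 N x))"
    unfolding Md_def
  proof (rule SUP_least)
    fix Q assume "Q \<in> {Q \<in> dyadic n (cube n a l). x \<in> Q}"
    then obtain j k where Q: "Q = D j k" "k \<in> idx n j" "x \<in> D j k"
      unfolding dyadic_cube[OF assms(1) l_pos] by blast
    have "avg n Q (\<lambda>y. \<bar>f y\<bar>) = X j x"
      using generic_X[OF assms(2) Q(2,3)] by (simp add: Q(1) A_def)
    then have "avg n Q (\<lambda>y. \<bar>f y\<bar>) \<le> MX 0 j x"
      using X_le_MX[of 0 j j x] by simp
    then show "ennreal (avg n Q (\<lambda>y. \<bar>f y\<bar>)) \<le> (SUP N. ennreal (MX 0 N x))"
      by (intro SUP_upper2[of j] ennreal_leI) auto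
  qed
  show "(SUP N. ennreal (MX 0 N x)) \<le> Md n (cube n a l) f x"
  proof (rule SUP_least)
    fix N
    have "MX 0 N x \<in> (\<lambda>t. X t x) ` {0..N}"
      unfolding MX_def by (rule Max_in) auto
    then obtain t where t: "MX 0 N x = X t x"
      by blast
    obtain k where k: "k \<in> idx n t" "x \<in> D t k"
      using cube_covered[OF l_pos assms(3)] by blast
    have "D t k \<in> dyadic n (cube n a l)"
      using k unfolding dyadic_cube[OF assms(1) l_pos] by blast
    then show "ennreal (MX 0 N x) \<le> Md n (cube n a l) f x"
      unfolding t generic_X[OF assms(2) k] A_def Md_def
      using k by (intro SUP_upper) simp
  qed
qed

lemma nn_integral_Md_powr_le:
  assumes "1 \<le> n" "0 < q" "q < 1" "k \<in> idx n j"
  obtains m where "A j k \<le> m"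
    "AE x in leb n. x \<in> D j k \<longrightarrow> ennreal m \<le> Md n (cube n a l) f x"
    "(\<integral>\<^sup>+x. epowr (Md n (cube n a l) f x) q * indicator (D j k) x \<partial>leb n)
      \<le> ennreal (vol j * bellman q (A j k) m)"
proof -
  have "\<forall>i\<in>{0..j}. \<exists>k'. k' \<in> idx n i \<and> D j k \<subseteq> D i k'"
    using dcube_ancestor[OF l_pos assms(4)] by fastforce
  then obtain anc where anc: "\<And>i. i \<le> j \<Longrightarrow> anc i \<in> idx n i" "\<And>i. i \<le> j \<Longrightarrow> D j k \<subseteq> D i (anc i)"
    using bchoice[of "{0..j}"] by (metis atLeastAtMost_iff le0)
  \<comment> \<open>At generic points of \<open>D j k\<close> the levels up to j see only these
    ancestors, so the running maximum up to level j is constant there.\<close>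
  define m0 where "m0 = Max ((\<lambda>i. A i (anc i)) ` {0..j})"
  have MX_m0: "MX 0 j x = m0" if "generic n a l x" "x \<in> D j k" for x
  proof -
    have "X i x = A i (anc i)" if "i \<in> {0..j}" for i
      using that anc \<open>x \<in> D j k\<close> by (intro generic_X \<open>generic n a l x\<close>) auto
    then show ?thesis
      unfolding MX_def m0_def by (intro arg_cong[where f = Max] image_cong refl)
  qed
  have m0: "0 \<le> m0"
    unfolding m0_def using A_nonneg by (auto intro!: Max_ge_iff[THEN iffD2])
  let ?G = "\<lambda>N x. ennreal (max m0 (MX j (j + N) x) powr q) * indicator (D j k) x"
  have Q: "D j k \<subseteq> cube n a l"
    using dcube_subset_cube[OF l_pos assms(4)] .
  have "(\<integral>\<^sup>+x. epowr (Md n (cube n a l) f x) q * indicator (D j k) x \<partial>leb n) \<le>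
      (\<integral>\<^sup>+x. (SUP N. ?G N x) \<partial>leb n)"
  proof (rule nn_integral_mono_AE)
    show "AE x in leb n. epowr (Md n (cube n a l) f x) q * indicator (D j k) x \<le> (SUP N. ?G N x)"
      using AE_generic[of n a l]
    proof eventually_elim
      case (elim x)
      show ?case
      proof (cases "x \<in> D j k")
        case True
        have "epowr (Md n (cube n a l) f x) q \<le> (SUP N. ennreal (MX 0 N x powr q))"
          unfolding Md_generic[OF assms(1) elim subsetD[OF Q True]]
          using assms MX_nonneg by (intro epowr_SUP_le) auto
        also have "\<dots> \<le> (SUP N. ?G N x)"
        \<comment> \<open>The levels up to N are enlarged to those up to j + N and split at j; the
          first part contributes \<open>m0\<close>.\<close>
        proof (rule SUP_mono)
          fix N
          have "MX 0 N x \<le> max m0 (MX j (j + N) x)"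
            using MX_mono[of 0 N "j + N" x] MX_split[of 0 j "j + N" x] MX_m0[OF elim True] by simp
          then have "ennreal (MX 0 N x powr q) \<le> ?G N x"
            using True assms MX_nonneg[of 0 N x] by (simp add: ennreal_leI powr_mono2)
          then show "\<exists>N'\<in>UNIV. ennreal (MX 0 N x powr q) \<le> ?G N' x"
            by blast
        qed
        finally show ?thesis
          using True by simp
      qed simp
    qed
  qed
  also have "\<dots> = (SUP N. \<integral>\<^sup>+x. ?G N x \<partial>leb n)"
  proof (rule nn_integral_monotone_convergence_SUP)
    show "incseq ?G"
    proof (intro incseq_SucI le_funI mult_right_mono ennreal_leI powr_mono2)
      fix N x
      show "max m0 (MX j (j + N) x) \<le> max m0 (MX j (j + Suc N) x)"
        by (intro max.mono MX_mono) auto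
    qed (use m0 assms in auto)
  qed measurable
  also have "\<dots> \<le> ennreal (vol j * bellman q (A j k) (max m0 (A j k)))"
    using assms m0 by (intro SUP_least nn_integral_MX_powr_le)
  finally have *: "(\<integral>\<^sup>+x. epowr (Md n (cube n a l) f x) q * indicator (D j k) x \<partial>leb n)
    \<le> ennreal (vol j * bellman q (A j k) (max m0 (A j k)))" .
  have "AE x in leb n. x \<in> D j k \<longrightarrow> ennreal (max m0 (A j k)) \<le> Md n (cube n a l) f x"
    using AE_generic[of n a l]
  proof eventually_elim
    case (elim x)
    show ?case
    proof
      assume x: "x \<in> D j k"
      \<comment> \<open>Level j is already among those in \<open>m0\<close>; the outer maximum only
        keeps the form of the Bellman estimate.\<close>
      have "max m0 (A j k) = MX 0 j x"
        using X_le_MX[of 0 j j x] MX_m0[OF elim x] generic_X[OF elim assms(4) x] by simp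
      then show "ennreal (max m0 (A j k)) \<le> Md n (cube n a l) f x"
        unfolding Md_generic[OF assms(1) elim subsetD[OF Q x]] by (auto intro: SUP_upper)
    qed
  qed
  then show ?thesis
    using * by (intro that[of "max m0 (A j k)"]) auto
qed

section \<open>Finiteness, measurability and integrability of powers of the maximal function\<close>

lemma cube_eq_D: "cube n a l = D 0 (\<lambda>i\<in>{..<n}. 0)" "(\<lambda>i\<in>{..<n}. 0) \<in> idx n 0"
  unfolding dcube_0 idx_0 by auto

lemma cube_powr_measurable:
  assumes "1 \<le> n"
  shows "(\<lambda>x. epowr (Md n (cube n a l) f x) q * indicator (cube n a l) x) \<in> borel_measurable (leb n)"
  unfolding leb_def
proof (rule borel_measurable_AE_completion)
  show "(\<lambda>x. epowr (SUP N. ennreal (MX 0 N x)) q * indicator (cube n a l) x)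
      \<in> borel_measurable (completion (Pi\<^sub>M {..<n} (\<lambda>_. lborel)))"
    unfolding leb_def[symmetric] by measurable
  show "AE x in completion (Pi\<^sub>M {..<n} (\<lambda>_. lborel)).
      epowr (SUP N. ennreal (MX 0 N x)) q * indicator (cube n a l) x =
      epowr (Md n (cube n a l) f x) q * indicator (cube n a l) x"
    using AE_generic[of n a l] unfolding leb_def[symmetric]
    by eventually_elim (auto simp: indicator_def Md_generic[OF assms])
qed

text \<open>A power of the maximal function has finite integral over the whole cube; 1/2 stands for
  any exponent between 0 and 1.\<close>

lemma AE_Md_finite:
  assumes "1 \<le> n"
  shows "AE x in leb n. x \<in> cube n a l \<longrightarrow> Md n (cube n a l) f x < \<infinity>"
proof -
  obtain m where "(\<integral>\<^sup>+x. epowr (Md n (cube n a l) f x) (1 / 2) * indicator (cube n a l) x \<partial>leb n)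
      \<le> ennreal (vol 0 * bellman (1 / 2) (A 0 (\<lambda>i\<in>{..<n}. 0)) m)"
    unfolding cube_eq_D(1)[symmetric]
    by (rule nn_integral_Md_powr_le[OF assms _ _ cube_eq_D(2), of "1 / 2"]) (auto simp: dcube_0)
  then have "(\<integral>\<^sup>+x. epowr (Md n (cube n a l) f x) (1 / 2) * indicator (cube n a l) x \<partial>leb n) \<noteq> \<infinity>"
    by (metis ennreal_neq_top infinity_ennreal_def top.extremum_uniqueI)
  then have "AE x in leb n. epowr (Md n (cube n a l) f x) (1 / 2) * indicator (cube n a l) x \<noteq> \<infinity>"
    by (intro nn_integral_PInf_AE cube_powr_measurable assms)
  then show ?thesis
    by eventually_elim (auto simp: less_top epowr_less_top_iff[unfolded infinity_ennreal_def])
qed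

text \<open>\<open>enn2real\<close> sends infinity to 0, which for n \<ge> 1 alters the power only
  on a null subset of the cube, by \<open>AE_Md_finite\<close>.\<close>

definition F :: "real \<Rightarrow> (nat \<Rightarrow> real) \<Rightarrow> real" where
  "F q x = enn2real (epowr (Md n (cube n a l) f x) q)"

lemma F_nonneg: "0 \<le> F q x"
  by (simp add: F_def)

lemma F_measurable:
  assumes "1 \<le> n" "k \<in> idx n j"
  shows "(\<lambda>x. indicator (D j k) x * F q x) \<in> borel_measurable (leb n)"
proof -
  have "(\<lambda>x. indicator (D j k) x *
      enn2real (epowr (Md n (cube n a l) f x) q * indicator (cube n a l) x)) \<in> borel_measurable (leb n)"
    using cube_powr_measurable[OF assms(1)] by measurable
  also have "(\<lambda>x. indicator (D j k) x *
      enn2real (epowr (Md n (cube n a l) f x) q * indicator (cube n a l) x)) =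
      (\<lambda>x. indicator (D j k) x * F q x)"
    using dcube_subset_cube[OF l_pos assms(2)] by (auto simp: F_def indicator_def fun_eq_iff)
  finally show ?thesis .
qed

text \<open>The upper bound passes to real integrals because \<open>enn2real\<close> never increases
  a value. The lower bound needs finiteness almost everywhere, since \<open>F q\<close> is 0 where
  \<open>Md\<close> is infinite.\<close>

lemma F_integral:
  assumes "1 \<le> n" "0 < q" "q < 1" "k \<in> idx n j"
  obtains m where "A j k \<le> m" "AE x in leb n. x \<in> D j k \<longrightarrow> m powr q \<le> F q x"
    "set_integrable (leb n) (D j k) (F q)"
    "(LINT x:D j k|leb n. F q x) \<le> vol j * bellman q (A j k) m"
proof -
  obtain m where m: "A j k \<le> m"
    "AE x in leb n. x \<in> D j k \<longrightarrow> ennreal m \<le> Md n (cube n a l) f x"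
    "(\<integral>\<^sup>+x. epowr (Md n (cube n a l) f x) q * indicator (D j k) x \<partial>leb n)
      \<le> ennreal (vol j * bellman q (A j k) m)"
    using nn_integral_Md_powr_le[OF assms] .
  have m0: "0 \<le> m"
    using m(1) A_nonneg[of j k] by simp
  have "(\<integral>\<^sup>+x. ennreal (indicator (D j k) x * F q x) \<partial>leb n) \<le>
      (\<integral>\<^sup>+x. epowr (Md n (cube n a l) f x) q * indicator (D j k) x \<partial>leb n)"
    by (intro nn_integral_mono) (auto simp: F_def indicator_def ennreal_enn2real_if)
  also note m(3)
  finally have nn: "(\<integral>\<^sup>+x. ennreal (indicator (D j k) x * F q x) \<partial>leb n) \<le>
    ennreal (vol j * bellman q (A j k) m)" .
  have int: "integrable (leb n) (\<lambda>x. indicator (D j k) x * F q x)"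
  proof (rule integrableI_nonneg)
    show "(\<integral>\<^sup>+x. ennreal (indicator (D j k) x * F q x) \<partial>leb n) < \<infinity>"
      using nn by (rule le_less_trans) simp
  qed (use F_measurable assms F_nonneg in auto)
  have "ennreal (LINT x|leb n. indicator (D j k) x * F q x) \<le> ennreal (vol j * bellman q (A j k) m)"
    using nn by (subst (asm) nn_integral_eq_integral[OF int]) (auto simp: F_nonneg)
  then have "(LINT x|leb n. indicator (D j k) x * F q x) \<le> vol j * bellman q (A j k) m"
    using vol_pos[of j] assms A_nonneg[of j k] by (subst (asm) ennreal_le_iff) (auto simp: bellman_def)
  moreover have "AE x in leb n. x \<in> D j k \<longrightarrow> m powr q \<le> F q x"
    using m(2) AE_Md_finite[OF assms(1)]
  proof eventually_elim
    case (elim x)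
    show ?case
    proof
      assume x: "x \<in> D j k"
      then have "Md n (cube n a l) f x < \<infinity>"
        using elim(2) dcube_subset_cube[OF l_pos assms(4)] by auto
      then obtain r where r: "0 \<le> r" "Md n (cube n a l) f x = ennreal r"
        by (cases "Md n (cube n a l) f x") auto
      then have "m \<le> r"
        using elim(1) x by simp
      then show "m powr q \<le> F q x"
        using assms m0 r by (simp add: F_def epowr_def powr_mono2)
    qed
  qed
  ultimately show ?thesis
    using m(1) int by (intro that[of m]) (auto simp: set_integrable_def set_lebesgue_integral_def)
qed

section \<open>Mean oscillation on a single dyadic cube\<close>

lemma oscillation_le:
  assumes "1 \<le> n" "0 < q" "q < 1" "k \<in> idx n j"
  shows "avg n (D j k) (\<lambda>x. \<bar>F q x - avg n (D j k) (F q)\<bar>) \<le> 2 * (q / (1 - q)) * A j k powr q"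
proof -
  obtain m where m: "A j k \<le> m" "AE x in leb n. x \<in> D j k \<longrightarrow> m powr q \<le> F q x"
    "set_integrable (leb n) (D j k) (F q)"
    "(LINT x:D j k|leb n. F q x) \<le> vol j * bellman q (A j k) m"
    using F_integral[OF assms] .
  define FQ where "FQ = avg n (D j k) (F q)"
  have const: "set_integrable (leb n) (D j k) (\<lambda>_. c :: real)" for c
    by (intro set_integrable_D set_integrable_const assms)
  have const_int: "(LINT x:D j k|leb n. c) = vol j * c" for c :: real
    by (subst set_integral_const) (auto simp: emeasure_D measure_D)
  have I: "(LINT x:D j k|leb n. F q x) = vol j * FQ"
    using vol_pos[of j] by (simp add: FQ_def avg_def measure_D)
  have "FQ \<le> bellman q (A j k) m"
    using m(4) vol_pos[of j] unfolding I by simp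
  also have "\<dots> \<le> m powr q + q / (1 - q) * A j k powr q"
    using assms A_nonneg m by (intro bellman_le) auto
  finally have FQ_le: "FQ \<le> m powr q + q / (1 - q) * A j k powr q" .
  have "(LINT x:D j k|leb n. m powr q) \<le> (LINT x:D j k|leb n. F q x)"
    using m by (intro set_integral_mono_AE const) auto
  then have FQ_ge: "m powr q \<le> FQ"
    unfolding I const_int using vol_pos[of j] by simp
  \<comment> \<open>Both \<open>F q x\<close> and \<open>FQ\<close> are at least m^q, so their
    distance is at most the sum of their excesses over m^q. The two excesses have the same
    average.\<close>
  have "(LINT x:D j k|leb n. \<bar>F q x - FQ\<bar>) \<le> (LINT x:D j k|leb n. F q x + (FQ - 2 * m powr q))"
  proof (rule set_integral_mono_AE)
    show "AE x\<in>D j k in leb n. \<bar>F q x - FQ\<bar> \<le> F q x + (FQ - 2 * m powr q)"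
      using m(2) by eventually_elim (use FQ_ge in auto)
  qed (intro set_integrable_abs set_integral_diff set_integral_add m const)+
  also have "\<dots> = vol j * (2 * (FQ - m powr q))"
    by (subst set_integral_add) (simp_all add: m const const_int I algebra_simps)
  finally have "avg n (D j k) (\<lambda>x. \<bar>F q x - FQ\<bar>) \<le> 2 * (FQ - m powr q)"
    using vol_pos[of j] by (simp add: avg_def measure_D field_simps)
  also have "\<dots> \<le> 2 * (q / (1 - q)) * A j k powr q"
    using FQ_le by simp
  finally show ?thesis
    by (simp add: FQ_def)
qed

section \<open>Summation over disjoint cubes\<close>

lemma sum_disjoint_integral_le:
  assumes "1 \<le> n" "finite C" "C \<subseteq> dyadic n (cube n a l)"
    "disjoint_family_on (cube_interior n) C"
  shows "(\<Sum>Q\<in>C. LINT x:Q|leb n. \<bar>f x\<bar>) \<le> L1_norm n (cube n a l) f"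
proof -
  have dyad: "\<exists>j k. k \<in> idx n j \<and> Q = D j k" if "Q \<in> C" for Q
    using assms(3) that unfolding dyadic_cube[OF assms(1) l_pos] by blast
  have int: "integrable (leb n) (\<lambda>x. indicator Q x *\<^sub>R \<bar>f x\<bar>)" if "Q \<in> C" for Q
    using dyad[OF that] set_integrable_D[OF set_integrable_abs[OF integrable_f]]
    unfolding set_integrable_def by blast
  have "(\<Sum>Q\<in>C. LINT x:Q|leb n. \<bar>f x\<bar>) = (LINT x|leb n. (\<Sum>Q\<in>C. indicator Q x *\<^sub>R \<bar>f x\<bar>))"
    unfolding set_lebesgue_integral_def
    by (intro Bochner_Integration.integral_sum[symmetric] int)
  also have "\<dots> \<le> (LINT x|leb n. indicator (cube n a l) x *\<^sub>R \<bar>f x\<bar>)"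
  proof (rule integral_mono_AE)
    show "AE x in leb n. (\<Sum>Q\<in>C. indicator Q x *\<^sub>R \<bar>f x\<bar>) \<le> indicator (cube n a l) x *\<^sub>R \<bar>f x\<bar>"
      using AE_generic[of n a l]
    proof eventually_elim
      case (elim x)
      show ?case
      proof (cases "\<exists>Q\<in>C. x \<in> Q")
        case True
        then obtain Q where Q: "Q \<in> C" "x \<in> Q"
          by blast
        have int: "x \<in> cube_interior n R" if "R \<in> C" "x \<in> R" for R
          using dyad[OF that(1)] that(2) generic_mem_interior[OF elim] by blast
        \<comment> \<open>A generic point of two distinct cubes of the collection would be interior
          to both.\<close>
        have "x \<notin> R" if "R \<in> C" "R \<noteq> Q" for R
          using assms(4) int[OF Q] int[OF that(1)] that Q(1) unfolding disjoint_family_on_def by blast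
        then have "(\<Sum>R\<in>C. indicator R x *\<^sub>R \<bar>f x\<bar>) = (\<Sum>R\<in>C. if R = Q then \<bar>f x\<bar> else 0)"
          using Q by (intro sum.cong) auto
        also have "\<dots> = \<bar>f x\<bar>"
          using assms(2) Q by simp
        finally have "(\<Sum>R\<in>C. indicator R x *\<^sub>R \<bar>f x\<bar>) = \<bar>f x\<bar>" .
        moreover have "x \<in> cube n a l"
          using dyad[OF Q(1)] Q(2) dcube_subset_cube[OF l_pos, of _ n _ a] by blast
        ultimately show ?thesis
          by simp
      next
        case False
        then have "(\<Sum>R\<in>C. indicator R x *\<^sub>R \<bar>f x\<bar>) = 0"
          by (intro sum.neutral) auto
        then show ?thesis
          by simp
      qed
    qed
    show "integrable (leb n) (\<lambda>x. indicator (cube n a l) x *\<^sub>R \<bar>f x\<bar>)"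
      using set_integrable_abs[OF integrable_f] unfolding set_integrable_def .
  qed (intro Bochner_Integration.integrable_sum int)
  finally show ?thesis
    by (simp add: L1_norm_def set_lebesgue_integral_def)
qed

end

theorem theorem4p3:
  fixes p :: real
  assumes "1 < p"
  shows "\<exists>c::real. c > 0 \<and>
    (\<forall>n\<ge>1. \<forall>Q0 \<in> cubes n. \<forall>f \<in> L1 n Q0.
       (AE x in leb n. x \<in> Q0 \<longrightarrow> Md n Q0 f x < \<infinity>) \<and>
       (\<lambda>x. enn2real (epowr (Md n Q0 f x) (1 / p))) \<in> JNd p n Q0 \<and>
       epowr (JNd_norm p n Q0 (\<lambda>x. enn2real (epowr (Md n Q0 f x) (1 / p)))) p
         \<le> ennreal (c * L1_norm n Q0 f))"
proof (intro exI[of _ "(2 / (p - 1)) powr p"] conjI allI impI ballI)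
  show "0 < (2 / (p - 1)) powr p"
    using assms by simp
  fix n Q0 f assume n: "1 \<le> n" and Q0: "Q0 \<in> cubes n" and f: "f \<in> L1 n Q0"
  obtain a l where al: "0 < l" "Q0 = cube n a l"
    using Q0 unfolding cubes_def by blast
  interpret integrable_on_cube n a l f
    using al f by unfold_locales (auto simp: L1_def)
  \<comment> \<open>With this exponent the oscillation constant 2q/(1-q) becomes 2/(p-1), whose p-th
    power is the constant of the theorem.\<close>
  define q where "q = 1 / p"
  define c where "c = (2 / (p - 1)) powr p"
  have q: "0 < q" "q < 1" "q / (1 - q) = 1 / (p - 1)"
    using assms by (auto simp: q_def field_simps)
  have F: "(\<lambda>x. enn2real (epowr (Md n Q0 f x) (1 / p))) = F q"
    by (simp add: fun_eq_iff F_def al q_def)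
  show "AE x in leb n. x \<in> Q0 \<longrightarrow> Md n Q0 f x < \<infinity>"
    unfolding al by (rule AE_Md_finite[OF n])
  have term_le: "measure (leb n) Q * avg n Q (\<lambda>x. \<bar>F q x - avg n Q (F q)\<bar>) powr p
      \<le> c * (LINT x:Q|leb n. \<bar>f x\<bar>)" if "Q \<in> dyadic n Q0" for Q
  proof -
    obtain j k where Q: "Q = D j k" "k \<in> idx n j"
      using \<open>Q \<in> dyadic n Q0\<close> unfolding al dyadic_cube[OF n al(1)] by blast
    have "avg n Q (\<lambda>x. \<bar>F q x - avg n Q (F q)\<bar>) \<le> 2 / (p - 1) * A j k powr q"
      using oscillation_le[OF n q(1,2) Q(2)] unfolding q(3) Q(1) by simp
    moreover have "0 \<le> avg n Q (\<lambda>x. \<bar>F q x - avg n Q (F q)\<bar>)"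
      unfolding avg_def set_lebesgue_integral_def by (auto intro!: mult_nonneg_nonneg)
    ultimately have "avg n Q (\<lambda>x. \<bar>F q x - avg n Q (F q)\<bar>) powr p \<le>
        (2 / (p - 1) * A j k powr q) powr p"
      using assms by (intro powr_mono2) auto
    \<comment> \<open>As q p = 1, the p-th power is linear in the average; times the volume it
      becomes an integral of \<bar>f\<bar>.\<close>
    also have "\<dots> = c * A j k"
      using assms A_nonneg[of j k] by (subst powr_mult) (simp_all add: powr_powr c_def q_def)
    finally have "vol j * avg n Q (\<lambda>x. \<bar>F q x - avg n Q (F q)\<bar>) powr p \<le> vol j * (c * A j k)"
      using vol_pos[of j] by simp
    also have "\<dots> = c * (LINT x:Q|leb n. \<bar>f x\<bar>)"
      unfolding Q(1) vol_mult_A[symmetric] by simp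
    finally show ?thesis
      by (simp add: Q(1) measure_D)
  qed
  define S where "S = (SUP C \<in> {C. C \<subseteq> dyadic n Q0 \<and> countable C \<and>
      disjoint_family_on (cube_interior n) C}.
    \<Sum>\<^sub>\<infinity>Q\<in>C. ennreal (measure (leb n) Q * avg n Q (\<lambda>x. \<bar>F q x - avg n Q (F q)\<bar>) powr p))"
  have "S \<le> ennreal (c * L1_norm n Q0 f)"
    unfolding S_def
  proof (rule SUP_least)
    fix C assume "C \<in> {C. C \<subseteq> dyadic n Q0 \<and> countable C \<and> disjoint_family_on (cube_interior n) C}"
    then have C: "C \<subseteq> dyadic n Q0" "disjoint_family_on (cube_interior n) C"
      by auto
    let ?t = "\<lambda>Q. measure (leb n) Q * avg n Q (\<lambda>x. \<bar>F q x - avg n Q (F q)\<bar>) powr p"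
    \<comment> \<open>The infinite sum is the supremum of its finite partial sums, so finite
      subcollections suffice.\<close>
    have "(\<Sum>Q\<in>C'. ennreal (?t Q)) \<le> ennreal (c * L1_norm n Q0 f)" if C': "finite C'" "C' \<subseteq> C" for C'
    proof -
      have "(\<Sum>Q\<in>C'. ennreal (?t Q)) = ennreal (\<Sum>Q\<in>C'. ?t Q)"
        by (intro sum_ennreal) auto
      also have "\<dots> \<le> ennreal (\<Sum>Q\<in>C'. c * (LINT x:Q|leb n. \<bar>f x\<bar>))"
        using C C' by (intro ennreal_leI sum_mono term_le) auto
      also have "\<dots> \<le> ennreal (c * L1_norm n Q0 f)"
        unfolding sum_distrib_left[symmetric] al(2)
        using C C' disjoint_family_on_mono[OF C'(2) C(2)]
        by (intro ennreal_leI mult_left_mono sum_disjoint_integral_le n) (auto simp: al c_def)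
      finally show ?thesis .
    qed
    then show "(\<Sum>\<^sub>\<infinity>Q\<in>C. ennreal (?t Q)) \<le> ennreal (c * L1_norm n Q0 f)"
      by (subst nonneg_infsum_complete) (auto intro!: SUP_least)
  qed
  moreover have norm: "JNd_norm p n Q0 (F q) = epowr S (1 / p)"
    unfolding JNd_norm_def S_def ..
  ultimately show "epowr (JNd_norm p n Q0 (\<lambda>x. enn2real (epowr (Md n Q0 f x) (1 / p)))) p
      \<le> ennreal ((2 / (p - 1)) powr p * L1_norm n Q0 f)"
    using assms unfolding F norm by (subst epowr_epowr_inverse) (simp_all add: c_def)
  have "S < \<infinity>"
    using \<open>S \<le> ennreal (c * L1_norm n Q0 f)\<close> by (rule le_less_trans) simp
  moreover have "F q \<in> L1 n Q0"
    using F_integral[OF n q(1,2) cube_eq_D(2)] unfolding L1_def al dcube_0 by blast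
  ultimately show "(\<lambda>x. enn2real (epowr (Md n Q0 f x) (1 / p))) \<in> JNd p n Q0"
    unfolding F JNd_def by (simp add: norm epowr_less_top_iff[unfolded infinity_ennreal_def])
qed

end
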